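(* Let $X$ be a Banach space. Then (i) $K_{2}(X)\leqslant K_{1}(X)\leqslant 2K_{2}(X)$, and (ii) $K_{1}(X)\leqslant K_{3}(X)\leqslant 4K_{1}(X)$.
   Context: Banach spaces are infinite-dimensional, over the real or complex field; $B_X$ denotes the closed unit ball of $X$, and $\mathcal F_X$ the family of all weakly compact subsets of $B_X$. A sequence $(y_n)_{n=1}^\infty$ is a convex block subsequence of $(x_n)_{n=1}^\infty$ if there is a strictly increasing sequence of positive integers $(k_n)_{n=1}^\infty$ such that, with $k_0=0$, $y_n\in\operatorname{conv}\{x_i: k_{n-1}+1\leqslant i\leqslant k_n\}$ for every $n\in\mathbb N$. The collection of all convex block subsequences of $(x_n)$ is denoted $\operatorname{cbs}((x_n)_{n=1}^\infty)$. For a bounded sequence $(f_n)_{n=1}^\infty$ in $X^*$ define $$\alpha((f_n)_{n=1}^\infty)=\sup_{K\in\mathcal F_X}\limsup_{n\to\infty}\sup_{x\in K}|\langle f_n,x\rangle|,$$ $$\beta((f_n)_{n=1}^\infty)=\sup\Big\{\limsup_{n\to\infty}|\langle f_n,x_n\rangle| : (x_n)_{n=1}^\infty\subseteq B_X \text{ weakly null}\Big\},$$ $$\operatorname{ca}_{\rho^*}((f_n)_{n=1}^\infty)=\sup_{K\in\mathcal F_X}\inf_{n\in\mathbb N}\sup_{k,l\geqslant n}\sup_{x\in K}|\langle f_k-f_l,x\rangle|.$$ Define $$K_1(X)=\sup_{(f_n)}\ \inf_{(g_n)\in\operatorname{cbs}((f_n))}\alpha((g_n)_{n=1}^\infty),\qquad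 K_2(X)=\sup_{(f_n)}\ \inf_{(g_n)\in\operatorname{cbs}((f_n))}\beta((g_n)_{n=1}^\infty),$$ where both suprema are over all weak$^*$ null sequences $(f_n)_{n=1}^\infty$ in $B_{X^*}$, and $$K_3(X)=\sup_{(f_n)}\ \inf_{(g_n)\in\operatorname{cbs}((f_n))}\operatorname{ca}_{\rho^*}((g_n)_{n=1}^\infty),$$ where the supremum is over all weak$^*$ Cauchy sequences $(f_n)_{n=1}^\infty$ in $B_{X^*}$. *)

theory Defs
  imports "HOL-Analysis.Analysis"
begin

text \<open>
  A Banach space over the scalar field \<open>'k\<close> is a type of class \<^class>\<open>banach\<close> (a complete
  real normed space) with a \<open>'k\<close>-scalar multiplication \<open>sc\<close> that extends the real one and
  for which the norm is homogeneous. The intended scalars are the reals, where \<open>sc\<close>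
  is necessarily \<^const>\<open>scaleR\<close>, and the complex numbers.
\<close>

locale infdim_banach_space = vector_space sc
  for sc :: "'k::real_normed_field \<Rightarrow> 'a::banach \<Rightarrow> 'a" +
  assumes sc_of_real: "sc (of_real r) x = r *\<^sub>R x"
    and norm_sc: "norm (sc c x) = norm c * norm x"
    and infinite_dim: "\<not> (\<exists>B. finite B \<and> local.span B = UNIV)"

text \<open>
  The \<open>'k\<close>-linear bounded functionals, as a subset of the real Banach space of real-linear
  bounded maps into \<open>'k\<close>; the norm of the latter restricts to the dual norm.
\<close>

definition dual_space :: "('k::real_normed_field \<Rightarrow> 'a::banach \<Rightarrow> 'a) \<Rightarrow> ('a \<Rightarrow>\<^sub>L 'k) set"
  where "dual_space sc = {f. \<forall>c x. blinfun_apply f (sc c x) = c * blinfun_apply f x}"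

definition weak_topology :: "('k::real_normed_field \<Rightarrow> 'a::banach \<Rightarrow> 'a) \<Rightarrow> 'a topology"
  where "weak_topology sc =
    topology_generated_by {blinfun_apply f -` U | f U. f \<in> dual_space sc \<and> open U}"

definition weakly_compact_in_ball ::
    "('k::real_normed_field \<Rightarrow> 'a::banach \<Rightarrow> 'a) \<Rightarrow> 'a set set"
  where "weakly_compact_in_ball sc =
    {K. K \<subseteq> cball 0 1 \<and> compactin (weak_topology sc) K}"

definition weakly_null :: "('k::real_normed_field \<Rightarrow> 'a::banach \<Rightarrow> 'a) \<Rightarrow> (nat \<Rightarrow> 'a) \<Rightarrow> bool"
  where "weakly_null sc x \<longleftrightarrow> limitin (weak_topology sc) x 0 sequentially"

definition weak_star_null :: "(nat \<Rightarrow> 'a::banach \<Rightarrow>\<^sub>L 'k::real_normed_field) \<Rightarrow> bool"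
  where "weak_star_null f \<longleftrightarrow> (\<forall>x. (\<lambda>n. blinfun_apply (f n) x) \<longlonglongrightarrow> 0)"

definition weak_star_Cauchy :: "(nat \<Rightarrow> 'a::banach \<Rightarrow>\<^sub>L 'k::real_normed_field) \<Rightarrow> bool"
  where "weak_star_Cauchy f \<longleftrightarrow> (\<forall>x. Cauchy (\<lambda>n. blinfun_apply (f n) x))"

text \<open>
  Sequences are indexed from 0, so the \<open>n\<close>-th block \<open>k\<^bsub>n-1\<^esub> + 1 \<le> i \<le> k\<^sub>n\<close> (for \<open>n \<ge> 1\<close>) of a
  sequence indexed from 1 becomes the block \<open>k n \<le> i < k (n + 1)\<close> (for \<open>n \<ge> 0\<close>).
\<close>

definition cbs :: "(nat \<Rightarrow> 'v::real_vector) \<Rightarrow> (nat \<Rightarrow> 'v) set"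
  where "cbs x = {y. \<exists>k::nat \<Rightarrow> nat. k 0 = 0 \<and> strict_mono k \<and>
    (\<forall>n. y n \<in> convex hull (x ` {k n..<k (Suc n)}))}"

text \<open>
  All quantities below are suprema and infima of nonnegative reals; they are formed in
  \<^typ>\<open>ennreal\<close>, where the supremum over the empty set (as for \<open>K = {}\<close>) is 0.
\<close>

definition alpha_seq ::
    "('k::real_normed_field \<Rightarrow> 'a::banach \<Rightarrow> 'a) \<Rightarrow> (nat \<Rightarrow> 'a \<Rightarrow>\<^sub>L 'k) \<Rightarrow> ennreal"
  where "alpha_seq sc f =
    (SUP K \<in> weakly_compact_in_ball sc.
      limsup (\<lambda>n. SUP x\<in>K. ennreal (norm (blinfun_apply (f n) x))))"

definition beta_seq ::
    "('k::real_normed_field \<Rightarrow> 'a::banach \<Rightarrow> 'a) \<Rightarrow> (nat \<Rightarrow> 'a \<Rightarrow>\<^sub>L 'k) \<Rightarrow> ennreal"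
  where "beta_seq sc f =
    (SUP x \<in> {x. range x \<subseteq> cball 0 1 \<and> weakly_null sc x}.
      limsup (\<lambda>n. ennreal (norm (blinfun_apply (f n) (x n)))))"

definition ca_rho_star ::
    "('k::real_normed_field \<Rightarrow> 'a::banach \<Rightarrow> 'a) \<Rightarrow> (nat \<Rightarrow> 'a \<Rightarrow>\<^sub>L 'k) \<Rightarrow> ennreal"
  where "ca_rho_star sc f =
    (SUP K \<in> weakly_compact_in_ball sc.
      INF n. SUP k\<in>{n..}. SUP l\<in>{n..}. SUP x\<in>K. ennreal (norm (blinfun_apply (f k - f l) x)))"

definition K1 :: "('k::real_normed_field \<Rightarrow> 'a::banach \<Rightarrow> 'a) \<Rightarrow> ennreal"
  where "K1 sc =
    (SUP f \<in> {f. range f \<subseteq> dual_space sc \<inter> cball 0 1 \<and> weak_star_null f}.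
      INF g \<in> cbs f. alpha_seq sc g)"

definition K2 :: "('k::real_normed_field \<Rightarrow> 'a::banach \<Rightarrow> 'a) \<Rightarrow> ennreal"
  where "K2 sc =
    (SUP f \<in> {f. range f \<subseteq> dual_space sc \<inter> cball 0 1 \<and> weak_star_null f}.
      INF g \<in> cbs f. beta_seq sc g)"

definition K3 :: "('k::real_normed_field \<Rightarrow> 'a::banach \<Rightarrow> 'a) \<Rightarrow> ennreal"
  where "K3 sc =
    (SUP f \<in> {f. range f \<subseteq> dual_space sc \<inter> cball 0 1 \<and> weak_star_Cauchy f}.
      INF g \<in> cbs f. ca_rho_star sc g)"

end

theory Submission
  imports Defs
begin

text \<open>
  The bound of \<open>K1\<close> by \<open>K2\<close> rests on weakly compact sets being weakly sequentially compact. That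
  half of the Eberlein--Smulian theorem is obtained from the weak* compactness of the dual ball,
  without separation theorems, so it applies to real and complex scalars alike.

  For the bound of \<open>K3\<close> by \<open>K1\<close>, a weak* Cauchy sequence \<open>f\<close> in the dual ball has a weak* limit
  \<open>u\<close> there, \<open>(f - u) / 2\<close> is an admissible weak* null sequence, and \<open>g \<mapsto> u + 2 g\<close> maps its convex
  block subsequences to those of \<open>f\<close>.
\<close>

section \<open>The weak topology and the dual ball\<close>

lemma topspace_weak_topology [simp]:
  fixes sc :: "'k::real_normed_field \<Rightarrow> 'a::banach \<Rightarrow> 'a"
  shows "topspace (weak_topology sc) = UNIV"
proof -
  have "0 \<in> dual_space sc"
    by (simp add: dual_space_def)
  then have "UNIV \<in> {blinfun_apply f -` U | f U. f \<in> dual_space sc \<and> open U}"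
    by (intro CollectI exI[of _ 0] exI[of _ UNIV]) auto
  then show ?thesis
    unfolding weak_topology_def topology_generated_by_topspace by blast
qed

lemma continuous_map_weak_topology:
  assumes "f \<in> dual_space sc"
  shows "continuous_map (weak_topology sc) euclidean (blinfun_apply f)"
proof -
  have "openin (weak_topology sc) (blinfun_apply f -` U)" if "open U" for U
    unfolding weak_topology_def using assms that by (intro topology_generated_by_Basis) auto
  moreover have "{x. blinfun_apply f x \<in> U} = blinfun_apply f -` U" for U
    by auto
  ultimately show ?thesis
    by (simp add: continuous_map)
qed

text \<open>Eventual membership survives finite intersections and arbitrary unions, so induction on
  how an open set is generated leaves only the preimages under single functionals.\<close>

lemma limitin_weak_topology_iff:
  "limitin (weak_topology sc) x l F \<longleftrightarrow>
    (\<forall>f\<in>dual_space sc. ((\<lambda>n. blinfun_apply f (x n)) \<longlongrightarrow> blinfun_apply f l) F)"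
proof safe
  fix f
  assume "limitin (weak_topology sc) x l F" "f \<in> dual_space sc"
  then have "limitin euclidean (blinfun_apply f \<circ> x) (blinfun_apply f l) F"
    by (intro continuous_map_limit[OF continuous_map_weak_topology])
  then show "((\<lambda>n. blinfun_apply f (x n)) \<longlongrightarrow> blinfun_apply f l) F"
    by (simp add: o_def)
next
  assume lim: "\<forall>f\<in>dual_space sc. ((\<lambda>n. blinfun_apply f (x n)) \<longlongrightarrow> blinfun_apply f l) F"
  have "eventually (\<lambda>n. x n \<in> U) F"
    if "generate_topology_on {blinfun_apply f -` U | f U. f \<in> dual_space sc \<and> open U} U" "l \<in> U"
    for U
    using that
  proof induction
    case (Int a b)
    then show ?case by (auto intro: eventually_conj)
  next
    case (UN K)
    then obtain k where "k \<in> K" "eventually (\<lambda>n. x n \<in> k) F"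
      by auto
    then show ?case
      by (auto elim!: eventually_mono)
  next
    case (Basis s)
    then obtain f U where "s = blinfun_apply f -` U" "f \<in> dual_space sc" "open U"
      by auto
    with lim Basis(2) show ?case
      by (auto simp: tendsto_def)
  qed simp
  then show "limitin (weak_topology sc) x l F"
    by (simp add: limitin_def)
      (simp add: weak_topology_def openin_topology_generated_by_iff)
qed

lemma weakly_null_iff:
  "weakly_null sc x \<longleftrightarrow> (\<forall>f\<in>dual_space sc. (\<lambda>n. blinfun_apply f (x n)) \<longlonglongrightarrow> 0)"
  by (simp add: weakly_null_def limitin_weak_topology_iff blinfun.zero_right)

section \<open>The dual ball as a compact set of functions\<close>

text \<open>Pointwise conditions alone describe the dual ball inside the product space, which makes
  closedness and stability under pointwise limits immediate. The bound by \<open>norm x\<close>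
  already forces a real-linear \<open>\<phi>\<close> to be bounded.\<close>

lemma dual_ball_apply_image:
  fixes sc :: "'k::real_normed_field \<Rightarrow> 'a::banach \<Rightarrow> 'a"
  shows "blinfun_apply ` (dual_space sc \<inter> cball 0 1) =
    {\<phi>. \<forall>x. norm (\<phi> x) \<le> norm x} \<inter>
    ({\<phi>. \<forall>x y. \<phi> (x + y) = \<phi> x + \<phi> y} \<inter> {\<phi>. \<forall>r x. \<phi> (r *\<^sub>R x) = r *\<^sub>R \<phi> x} \<inter>
     {\<phi>. \<forall>c x. \<phi> (sc c x) = c * \<phi> x})" (is "?L = ?R")
proof safe
  fix f :: "'a \<Rightarrow>\<^sub>L 'k" and x
  assume "f \<in> cball 0 1"
  then show "norm (blinfun_apply f x) \<le> norm x"
    using norm_blinfun[of f x] mult_right_mono[of "norm f" 1 "norm x"] by simp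
next
  fix \<phi> :: "'a \<Rightarrow> 'k"
  assume bd: "\<forall>x. norm (\<phi> x) \<le> norm x"
    and "\<forall>x y. \<phi> (x + y) = \<phi> x + \<phi> y" "\<forall>r x. \<phi> (r *\<^sub>R x) = r *\<^sub>R \<phi> x"
    and sc: "\<forall>c x. \<phi> (sc c x) = c * \<phi> x"
  then have "bounded_linear \<phi>"
    by (intro bounded_linear_intro[of _ 1]) auto
  then have eq: "blinfun_apply (Blinfun \<phi>) = \<phi>"
    by (rule bounded_linear_Blinfun_apply)
  with bd have "norm (Blinfun \<phi>) \<le> 1"
    by (intro norm_blinfun_bound) auto
  with eq sc have "Blinfun \<phi> \<in> dual_space sc \<inter> cball 0 1"
    by (simp add: dual_space_def)
  with eq show "\<phi> \<in> ?L"
    by (metis image_eqI)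
qed (auto simp: dual_space_def blinfun.add_right blinfun.scaleR_right)

lemma continuous_on_apply:
  "continuous_on A (\<lambda>\<phi>::'i \<Rightarrow> 'b::topological_space. \<phi> i)"
  by (rule continuous_on_subset[OF continuous_on_product_coordinates]) simp

lemma closed_dual_ball_apply_image:
  fixes sc :: "'k::real_normed_field \<Rightarrow> 'a::banach \<Rightarrow> 'a"
  shows "closed (blinfun_apply ` (dual_space sc \<inter> cball 0 1))"
  unfolding dual_ball_apply_image
  by (intro closed_Int closed_Collect_all closed_Collect_eq closed_Collect_le
      continuous_on_norm continuous_on_add continuous_on_scaleR continuous_on_mult
      continuous_on_const continuous_on_apply)

text \<open>Tychonoff: a product of closed balls in the finite-dimensional scalars is compact, and
  the dual ball is a closed part of it.\<close>

lemma banach_alaoglu: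
  fixes sc :: "'k::{real_normed_field, euclidean_space} \<Rightarrow> 'a::banach \<Rightarrow> 'a"
  shows "compact (blinfun_apply ` (dual_space sc \<inter> cball 0 1))"
proof -
  have eq: "{\<phi>::'a \<Rightarrow> 'k. \<forall>x. norm (\<phi> x) \<le> norm x} = PiE UNIV (\<lambda>x. cball 0 (norm x))"
    by (auto simp: PiE_def)
  have "compactin (product_topology (\<lambda>x::'a. euclidean :: 'k topology) UNIV)
          (PiE UNIV (\<lambda>x. cball 0 (norm x)))"
    unfolding compactin_PiE by simp
  then have "compact {\<phi>::'a \<Rightarrow> 'k. \<forall>x. norm (\<phi> x) \<le> norm x}"
    by (simp add: euclidean_product_topology eq)
  then have "compact ({\<phi>::'a \<Rightarrow> 'k. \<forall>x. norm (\<phi> x) \<le> norm x} \<inter>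
      blinfun_apply ` (dual_space sc \<inter> cball 0 1))"
    by (rule compact_Int_closed[OF _ closed_dual_ball_apply_image])
  then show ?thesis
    unfolding dual_ball_apply_image by (simp flip: Int_assoc)
qed

text \<open>
  The image of the dual ball under evaluation at the points \<open>x n\<close> is separable; the closure of a
  countable set with dense image is compact, so it is mapped onto that whole image.
\<close>

lemma countable_determining_functionals:
  fixes sc :: "'k::{real_normed_field, euclidean_space} \<Rightarrow> 'a::banach \<Rightarrow> 'a"
    and x :: "nat \<Rightarrow> 'a"
  obtains D where "countable D" "D \<subseteq> dual_space sc \<inter> cball 0 1"
    "\<And>f. f \<in> dual_space sc \<inter> cball 0 1 \<Longrightarrow>
      \<exists>g\<in>dual_space sc \<inter> cball 0 1. (\<forall>n. blinfun_apply g (x n) = blinfun_apply f (x n)) \<and>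
        (\<forall>u v. (\<forall>d\<in>D. blinfun_apply d u = blinfun_apply d v) \<longrightarrow>
          blinfun_apply g u = blinfun_apply g v)"
proof -
  define B where "B = dual_space sc \<inter> cball 0 1"
  define S where "S = blinfun_apply ` B"
  define \<Phi> :: "('a \<Rightarrow> 'k) \<Rightarrow> nat \<Rightarrow> 'k" where "\<Phi> = (\<lambda>\<phi> n. \<phi> (x n))"
  have S: "compact S"
    unfolding S_def B_def by (rule banach_alaoglu)
  have cont: "continuous_on A \<Phi>" for A
    unfolding \<Phi>_def by (intro continuous_on_coordinatewise_then_product continuous_on_apply)
  \<comment> \<open>The space \<open>nat \<Rightarrow> 'k\<close> of values at the points
    \<open>x n\<close> is second countable, so every subset of it has a countable dense
    subset.\<close>
  obtain T where T: "countable T" "T \<subseteq> \<Phi> ` S" "\<Phi> ` S \<subseteq> closure T"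
    using separable by metis
  then obtain D where D: "countable D" "D \<subseteq> B" "T = (\<lambda>d. \<Phi> (blinfun_apply d)) ` D"
    unfolding S_def image_image by (metis (no_types, lifting) countable_image_eq_inj countable_subset_image)
  define C where "C = closure (blinfun_apply ` D)"
  have "C \<subseteq> S"
    unfolding C_def using D closed_dual_ball_apply_image[of sc]
    by (intro closure_minimal) (auto simp: S_def B_def)
  then have "compact C"
    using S by (metis C_def closed_closure compact_Int_closed inf.absorb_iff2)
  then have "closed (\<Phi> ` C)"
    by (intro compact_imp_closed compact_continuous_image cont)
  moreover have "T \<subseteq> \<Phi> ` C"
    using D closure_subset[of "blinfun_apply ` D"] by (auto simp: C_def)
  ultimately have onto: "\<Phi> ` S \<subseteq> \<Phi> ` C"
    using T closure_minimal by blast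
  \<comment> \<open>For fixed \<open>u\<close> and \<open>v\<close> the equation
    \<open>\<phi> u = \<phi> v\<close> is closed in \<open>\<phi>\<close>, so it extends from
    \<open>D\<close> to its closure \<open>C\<close>.\<close>
  have agree: "\<phi> u = \<phi> v"
    if "\<phi> \<in> C" "\<forall>d\<in>D. blinfun_apply d u = blinfun_apply d v" for \<phi> u v
  proof -
    have "closed {\<phi>::'a \<Rightarrow> 'k. \<phi> u = \<phi> v}"
      by (intro closed_Collect_eq continuous_on_apply)
    then have "C \<subseteq> {\<phi>. \<phi> u = \<phi> v}"
      unfolding C_def using that by (intro closure_minimal) auto
    with that show ?thesis by blast
  qed
  have "\<exists>g\<in>B. (\<forall>n. blinfun_apply g (x n) = blinfun_apply f (x n)) \<and>
        (\<forall>u v. (\<forall>d\<in>D. blinfun_apply d u = blinfun_apply d v) \<longrightarrow>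
          blinfun_apply g u = blinfun_apply g v)" if "f \<in> B" for f
  proof -
    have "\<Phi> (blinfun_apply f) \<in> \<Phi> ` C"
      using onto that by (auto simp: S_def)
    then obtain \<phi> where \<phi>: "\<phi> \<in> C" "\<Phi> (blinfun_apply f) = \<Phi> \<phi>"
      by blast
    then obtain g where g: "g \<in> B" "\<phi> = blinfun_apply g"
      using \<open>C \<subseteq> S\<close> by (auto simp: S_def)
    have "\<forall>n. blinfun_apply g (x n) = blinfun_apply f (x n)"
      using \<phi>(2) g(2) by (simp add: \<Phi>_def fun_eq_iff)
    moreover have "\<forall>u v. (\<forall>d\<in>D. blinfun_apply d u = blinfun_apply d v) \<longrightarrow>
          blinfun_apply g u = blinfun_apply g v"
      using agree[OF \<phi>(1)] g(2) by blast
    ultimately show ?thesis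
      using g(1) by blast
  qed
  with D that show ?thesis
    unfolding B_def by blast
qed

section \<open>Weak sequential compactness\<close>

text \<open>Only the dual functionals are evaluated, since nothing else is weakly continuous.\<close>

definition weak_embed :: "('k::real_normed_field \<Rightarrow> 'a::banach \<Rightarrow> 'a) \<Rightarrow> 'a \<Rightarrow> ('a \<Rightarrow>\<^sub>L 'k) \<Rightarrow> 'k"
  where "weak_embed sc x = (\<lambda>f. if f \<in> dual_space sc then blinfun_apply f x else 0)"

lemma continuous_map_weak_embed:
  "continuous_map (weak_topology sc) euclidean (weak_embed sc)"
proof -
  have "continuous_map (weak_topology sc) euclidean (\<lambda>x. weak_embed sc x f)" for f
    by (cases "f \<in> dual_space sc") (auto simp: weak_embed_def continuous_map_weak_topology)
  then show ?thesis
    by (simp add: continuous_map_componentwise_UNIV flip: euclidean_product_topology)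
qed

section \<open>Cluster points of sequences in compact spaces\<close>

text \<open>Compactness is applied to \<open>sequentially\<close> restricted to the indices with
  \<open>y n \<in> V\<close>. Choosing \<open>V\<close> as the complement of an open set produces a
  cluster point outside that set.\<close>

lemma frequently_cluster_point:
  fixes y :: "nat \<Rightarrow> 'b::topological_space"
  assumes C: "compact C" "closed V" and y: "\<And>n. y n \<in> C" "frequently (\<lambda>n. y n \<in> V) sequentially"
  obtains z where "z \<in> C" "z \<in> V"
    "\<And>U. open U \<Longrightarrow> z \<in> U \<Longrightarrow> frequently (\<lambda>n. y n \<in> U) sequentially"
proof -
  define F where "F = inf sequentially (principal {n. y n \<in> V})"
  have "F \<noteq> bot"
    using y(2) by (auto simp: F_def trivial_limit_def eventually_inf_principal frequently_def)
  then have "filtermap y F \<noteq> bot"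
    by (simp add: filtermap_bot_iff)
  moreover have "eventually (\<lambda>w. w \<in> C \<inter> V) (filtermap y F)"
    by (simp add: eventually_filtermap F_def eventually_inf_principal y)
  moreover have "compact (C \<inter> V)"
    using C by (rule compact_Int_closed)
  ultimately have "\<exists>z\<in>C \<inter> V. inf (nhds z) (filtermap y F) \<noteq> bot"
    unfolding compact_filter by blast
  then obtain z where z: "z \<in> C \<inter> V" "inf (nhds z) (filtermap y F) \<noteq> bot"
    by blast
  have "frequently (\<lambda>n. y n \<in> U) sequentially" if U: "open U" "z \<in> U" for U
  proof (rule ccontr)
    assume "\<not> frequently (\<lambda>n. y n \<in> U) sequentially"
    then have "eventually (\<lambda>w. w \<notin> U) (filtermap y F)"
      by (auto simp: frequently_def eventually_filtermap F_def eventually_inf_principal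
          elim: eventually_mono)
    moreover have "eventually (\<lambda>w. w \<in> U) (nhds z)"
      using U by (rule eventually_nhds_in_open)
    ultimately have "eventually (\<lambda>w. False) (inf (nhds z) (filtermap y F))"
      unfolding eventually_inf by fastforce
    with z show False
      by (simp add: trivial_limit_def)
  qed
  with z that show ?thesis by blast
qed

lemma frequently_cluster_point_unique_lim:
  fixes y :: "nat \<Rightarrow> 'b::t2_space"
  assumes "\<And>U. open U \<Longrightarrow> z \<in> U \<Longrightarrow> frequently (\<lambda>n. y n \<in> U) sequentially" "y \<longlonglongrightarrow> l"
  shows "z = l"
proof (rule ccontr)
  assume "z \<noteq> l"
  then obtain U V where UV: "open U" "open V" "z \<in> U" "l \<in> V" "U \<inter> V = {}"
    using hausdorff by metis
  then have "eventually (\<lambda>n. y n \<in> V) sequentially"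
    using assms(2) by (simp add: tendsto_def)
  then have "eventually (\<lambda>n. \<not> y n \<in> U) sequentially"
    by eventually_elim (use UV in blast)
  with assms(1) UV show False
    by (simp add: frequently_def)
qed

text \<open>
  After passing to a subsequence along which the functionals of a countable determining set
  converge, any two weak cluster points agree on that set, hence on the whole dual.
\<close>

theorem eberlein:
  fixes sc :: "'k::{real_normed_field, euclidean_space} \<Rightarrow> 'a::banach \<Rightarrow> 'a"
  assumes K: "compactin (weak_topology sc) K" and x: "\<And>n. x n \<in> K"
  obtains l r where "l \<in> K" "strict_mono (r :: nat \<Rightarrow> nat)"
    "limitin (weak_topology sc) (x \<circ> r) l sequentially"
proof -
  define E where "E = weak_embed sc"
  have E: "E u f = blinfun_apply f u" if "f \<in> dual_space sc" for u f
    using that by (simp add: E_def weak_embed_def)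
  \<comment> \<open>Weak compactness is moved to a product of copies of the scalar field, where
    type-class compactness is available.\<close>
  have C: "compact (E ` K)"
    using image_compactin[OF K continuous_map_weak_embed] by (simp add: E_def)
  obtain D where D: "countable D" "D \<subseteq> dual_space sc \<inter> cball 0 1"
    and det: "\<And>f. f \<in> dual_space sc \<inter> cball 0 1 \<Longrightarrow>
      \<exists>g\<in>dual_space sc \<inter> cball 0 1. (\<forall>n. blinfun_apply g (x n) = blinfun_apply f (x n)) \<and>
        (\<forall>u v. (\<forall>d\<in>D. blinfun_apply d u = blinfun_apply d v) \<longrightarrow>
          blinfun_apply g u = blinfun_apply g v)"
    using countable_determining_functionals[of sc x] by metis
  have "0 \<in> dual_space sc \<inter> cball 0 1"
    by (simp add: dual_space_def)
  \<comment> \<open>Adjoining 0 makes the countable set nonempty, hence the range of a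
    sequence.\<close>
  then have "\<exists>d. D \<union> {0} = range (d :: nat \<Rightarrow> _)"
    using D by (metis Un_insert_right countable_Un countable_empty countable_insert insert_not_empty
        uncountable_def)
  then obtain d :: "nat \<Rightarrow> 'a \<Rightarrow>\<^sub>L 'k" where d: "range d = D \<union> {0}"
    by metis
  have dual: "d j \<in> dual_space sc" for j
  proof -
    have "d j \<in> D \<union> {0}"
      using d by (metis rangeI)
    with D \<open>0 \<in> dual_space sc \<inter> cball 0 1\<close> show ?thesis by auto
  qed
  have "compact ((\<lambda>\<phi> j. \<phi> (d j)) ` E ` K)"
    by (intro compact_continuous_image C continuous_on_coordinatewise_then_product
        continuous_on_apply)
  \<comment> \<open>Only countably many coordinates remain, so the ambient product is first
    countable and compactness yields a convergent subsequence.\<close>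
  then have "seq_compact ((\<lambda>\<phi> j. \<phi> (d j)) ` E ` K)"
    by (rule compact_imp_seq_compact)
  moreover have "\<forall>n. (\<lambda>j. E (x n) (d j)) \<in> (\<lambda>\<phi> j. \<phi> (d j)) ` E ` K"
    using x by auto
  ultimately obtain m and r :: "nat \<Rightarrow> nat"
    where r: "strict_mono r" "((\<lambda>n. (\<lambda>j. E (x n) (d j))) \<circ> r) \<longlonglongrightarrow> m"
    using seq_compactE by metis
  define y where "y = x \<circ> r"
  have lim: "(\<lambda>n. E (y n) (d j)) \<longlonglongrightarrow> m j" for j
    using continuous_on_tendsto_compose[OF continuous_on_apply[of UNIV j] r(2)]
    by (simp add: y_def o_def)
  have yK: "E (y n) \<in> E ` K" for n
    using x by (simp add: y_def)
  \<comment> \<open>\<open>P z\<close> says that \<open>z\<close> is a weak cluster point of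
    \<open>y\<close>.\<close>
  define P where "P = (\<lambda>z. \<forall>U. open U \<longrightarrow> E z \<in> U \<longrightarrow> frequently (\<lambda>n. E (y n) \<in> U) sequentially)"
  have cluster_D: "blinfun_apply e z = blinfun_apply e z'" if "P z" "P z'" "e \<in> D" for z z' e
  proof -
    obtain j where j: "e = d j"
      using d \<open>e \<in> D\<close> by (metis UnI1 imageE)
    have "E z (d j) = m j" if "P z" for z
    proof (rule frequently_cluster_point_unique_lim[OF _ lim])
      fix U :: "'k set"
      assume "open U" "E z (d j) \<in> U"
      moreover have "open ((\<lambda>\<phi>. \<phi> (d j)) -` U)"
        by (rule open_vimage[OF \<open>open U\<close> continuous_on_apply])
      ultimately show "frequently (\<lambda>n. E (y n) (d j) \<in> U) sequentially"
        using that unfolding P_def by fastforce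
    qed
    with that j show ?thesis
      using E[OF dual] by metis
  qed
  \<comment> \<open>If \<open>f\<close> and \<open>g\<close> differed at a cluster point
    \<open>z\<close>, the open condition \<open>\<phi> f \<noteq> \<phi> g\<close> would hold at
    some \<open>E (y n)\<close>, although the two agree at every \<open>x n\<close>.\<close>
  have same: "blinfun_apply f z = blinfun_apply g z"
    if "P z" "f \<in> dual_space sc" "g \<in> dual_space sc"
      "\<forall>n. blinfun_apply g (x n) = blinfun_apply f (x n)" for f g z
  proof (rule ccontr)
    assume ne: "\<not> ?thesis"
    have "open {\<phi> :: ('a \<Rightarrow>\<^sub>L 'k) \<Rightarrow> 'k. \<phi> f \<noteq> \<phi> g}"
      by (intro open_Collect_neq continuous_on_apply)
    with ne that have "frequently (\<lambda>n. E (y n) \<in> {\<phi>. \<phi> f \<noteq> \<phi> g}) sequentially"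
      unfolding P_def by (auto simp: E)
    with that show False
      by (simp add: E y_def)
  qed
  \<comment> \<open>Replacing \<open>f\<close> by the \<open>g\<close> that is determined by
    \<open>D\<close> gives \<open>f z = g z = g z' = f z'\<close>.\<close>
  have ball: "blinfun_apply f z = blinfun_apply f z'"
    if P: "P z" "P z'" and f: "f \<in> dual_space sc \<inter> cball 0 1" for z z' f
  proof -
    obtain g where g: "g \<in> dual_space sc" "\<forall>n. blinfun_apply g (x n) = blinfun_apply f (x n)"
      and "blinfun_apply g z = blinfun_apply g z'"
      using det[OF f] cluster_D P by blast
    with same[OF _ _ g] P f show ?thesis by simp
  qed
  have unique: "blinfun_apply f z = blinfun_apply f z'"
    if "P z" "P z'" "f \<in> dual_space sc" for z z' f
  proof (cases "f = 0")
    case False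
    have "(1 / norm f) *\<^sub>R f \<in> dual_space sc \<inter> cball 0 1"
      using that False by (simp add: dual_space_def blinfun.scaleR_left)
    from ball[OF that(1,2) this] False show ?thesis
      by (simp add: blinfun.scaleR_left)
  qed simp
  obtain l where l: "l \<in> K" "P l"
  proof (rule frequently_cluster_point[OF C closed_UNIV yK])
    show "frequently (\<lambda>n. E (y n) \<in> UNIV) sequentially"
      by simp
  qed (auto simp: P_def intro: that)
  \<comment> \<open>If convergence failed, some closed set missing \<open>f l\<close> would be
    visited infinitely often and would yield a cluster point \<open>l'\<close> with a different
    value of \<open>f\<close>, against \<open>unique\<close>.\<close>
  have "(\<lambda>n. blinfun_apply f (y n)) \<longlonglongrightarrow> blinfun_apply f l" if f: "f \<in> dual_space sc" for f
  proof (rule ccontr)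
    assume "\<not> ?thesis"
    then obtain U where U: "open U" "blinfun_apply f l \<in> U"
      "frequently (\<lambda>n. blinfun_apply f (y n) \<notin> U) sequentially"
      by (auto simp: tendsto_def frequently_def)
    have "closed ((\<lambda>\<phi> :: ('a \<Rightarrow>\<^sub>L 'k) \<Rightarrow> 'k. \<phi> f) -` (- U))"
      using U by (intro closed_vimage continuous_on_apply) auto
    then obtain l' where "l' \<in> K" "E l' f \<notin> U" "P l'"
    proof (rule frequently_cluster_point[OF C _ yK])
      show "frequently (\<lambda>n. E (y n) \<in> (\<lambda>\<phi>. \<phi> f) -` (- U)) sequentially"
        using U f by (simp add: E)
    qed (auto simp: P_def)
    with unique[OF l(2) _ f] U f show False
      by (auto simp: E)
  qed
  then have "limitin (weak_topology sc) (x \<circ> r) l sequentially"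
    by (simp add: limitin_weak_topology_iff y_def)
  with l r that show ?thesis by blast
qed

section \<open>Comparison of the quantities\<close>

text \<open>A weakly null sequence together with its limit 0 is a single weakly compact set.\<close>

lemma beta_seq_le_alpha_seq: "beta_seq sc g \<le> alpha_seq sc g"
  unfolding beta_seq_def
proof (rule SUP_least, safe)
  fix x :: "nat \<Rightarrow> _"
  assume x: "range x \<subseteq> cball 0 1" "weakly_null sc x"
  define K where "K = insert 0 (range x)"
  have "compactin (weak_topology sc) K"
    unfolding K_def using x(2) by (intro compactin_sequence_with_limit) (auto simp: weakly_null_def)
  with x have K: "K \<in> weakly_compact_in_ball sc"
    by (auto simp: weakly_compact_in_ball_def K_def)
  have "limsup (\<lambda>n. ennreal (norm (blinfun_apply (g n) (x n))))
      \<le> limsup (\<lambda>n. SUP x\<in>K. ennreal (norm (blinfun_apply (g n) x)))"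
    by (intro Limsup_mono always_eventually allI SUP_upper) (simp add: K_def)
  also have "\<dots> \<le> alpha_seq sc g"
    unfolding alpha_seq_def using K by (rule SUP_upper)
  finally show "limsup (\<lambda>n. ennreal (norm (blinfun_apply (g n) (x n)))) \<le> alpha_seq sc g" .
qed

text \<open>\<open>beta_seq\<close> pairs the \<open>n\<close>-th functional with the
  \<open>n\<close>-th point, so points found only along a subsequence have to be padded to a full
  sequence.\<close>

lemma tendsto_zero_extend_subseq:
  fixes h :: "nat \<Rightarrow> 'b::real_normed_vector"
  assumes p: "strict_mono p" and lim: "(\<lambda>n. h (p n)) \<longlonglongrightarrow> 0" and zero: "\<And>n. n \<notin> range p \<Longrightarrow> h n = 0"
  shows "h \<longlonglongrightarrow> 0"
proof (rule LIMSEQ_I)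
  fix e :: real
  assume "0 < e"
  then obtain N where N: "\<And>n. n \<ge> N \<Longrightarrow> norm (h (p n)) < e"
    using LIMSEQ_D[OF lim] by auto
  have "norm (h m) < e" if "m \<ge> p N" for m
  proof (cases "m \<in> range p")
    case True
    then obtain n where "m = p n" by auto
    with that p N show ?thesis by (simp add: strict_mono_less_eq)
  qed (use zero \<open>0 < e\<close> in simp)
  then show "\<exists>N. \<forall>n\<ge>N. norm (h n - 0) < e" by auto
qed

text \<open>
  Points of \<open>K\<close> almost realising \<open>alpha_seq\<close> converge weakly to some \<open>l\<close> along a subsequence;
  half their differences with \<open>l\<close>, padded by zeros, form a weakly null sequence in the ball.
\<close>

lemma alpha_seq_le_beta_seq:
  fixes sc :: "'k::{real_normed_field, euclidean_space} \<Rightarrow> 'a::banach \<Rightarrow> 'a"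
  assumes null: "weak_star_null g"
  shows "alpha_seq sc g \<le> 2 * beta_seq sc g"
  unfolding alpha_seq_def
proof (rule SUP_least)
  fix K
  assume "K \<in> weakly_compact_in_ball sc"
  then have K: "K \<subseteq> cball 0 1" "compactin (weak_topology sc) K"
    by (auto simp: weakly_compact_in_ball_def)
  let ?s = "\<lambda>n. SUP x\<in>K. ennreal (norm (blinfun_apply (g n) x))"
  show "limsup ?s \<le> 2 * beta_seq sc g"
  proof (rule dense_le)
    fix a
    assume "a < limsup ?s"
    \<comment> \<open>The room between \<open>a\<close> and \<open>b\<close> will absorb the values
      of the functionals at the weak limit \<open>l\<close>.\<close>
    then obtain b where ab: "a < b" "b < limsup ?s"
      using dense by blast
    then have "b < top" "a < top"
      by (auto intro: less_trans order_less_le_trans)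
    with ab obtain c c' where c: "a = ennreal c" "0 \<le> c" "b = ennreal c'" "c < c'"
      by (metis ennreal_cases ennreal_less_iff less_irrefl top.not_eq_extremum)
    have "frequently (\<lambda>n. b < ?s n) sequentially"
    proof (rule ccontr)
      assume "\<not> ?thesis"
      then have "eventually (\<lambda>n. ?s n \<le> b) sequentially"
        by (simp add: frequently_def not_less)
      then have "limsup ?s \<le> b"
        by (rule Limsup_bounded)
      with ab show False by simp
    qed
    then have "infinite {n. b < ?s n}"
      by (simp add: frequently_cofinite flip: cofinite_eq_sequentially)
    then obtain q :: "nat \<Rightarrow> nat" where q: "strict_mono q" "\<And>n. b < ?s (q n)"
      using infinite_enumerate by blast
    have "\<exists>x\<in>K. c' < norm (blinfun_apply (g (q n)) x)" for n
      using q(2)[of n] c by (auto simp: less_SUP_iff ennreal_less_iff)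
    then obtain x where x: "\<And>n. x n \<in> K" "\<And>n. c' < norm (blinfun_apply (g (q n)) (x n))"
      by metis
    obtain l and r :: "nat \<Rightarrow> nat" where l: "l \<in> K" "strict_mono r"
      "limitin (weak_topology sc) (x \<circ> r) l sequentially"
      by (rule eberlein[OF K(2) x(1)])
    define p where "p = q \<circ> r"
    have p: "strict_mono p"
      unfolding p_def using q(1) l(2) by (rule strict_mono_o)
    \<comment> \<open>The factor 1/2 brings differences of points of \<open>K\<close> back into the
      unit ball; it is the source of the constant 2.\<close>
    define z where "z = (\<lambda>m. if m \<in> range p then (1/2) *\<^sub>R (x (r (inv p m)) - l) else 0)"
    have zp: "z (p n) = (1/2) *\<^sub>R (x (r n) - l)" for n
      using strict_mono_imp_inj_on[OF p] by (simp add: z_def)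
    have "weakly_null sc z"
      unfolding weakly_null_iff
    proof
      fix f
      assume "f \<in> dual_space sc"
      then have "(\<lambda>n. blinfun_apply f (x (r n))) \<longlonglongrightarrow> blinfun_apply f l"
        using l(3) by (simp add: limitin_weak_topology_iff)
      then have "(\<lambda>n. (1/2) *\<^sub>R (blinfun_apply f (x (r n)) - blinfun_apply f l)) \<longlonglongrightarrow> (1/2) *\<^sub>R 0"
        by (intro tendsto_scaleR tendsto_const LIM_zero)
      then have "(\<lambda>n. blinfun_apply f (z (p n))) \<longlonglongrightarrow> 0"
        by (simp add: zp blinfun.scaleR_right blinfun.diff_right)
      moreover have "blinfun_apply f (z n) = 0" if "n \<notin> range p" for n
        using that by (simp add: z_def blinfun.zero_right)
      ultimately show "(\<lambda>n. blinfun_apply f (z n)) \<longlonglongrightarrow> 0"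
        by (rule tendsto_zero_extend_subseq[OF p])
    qed
    moreover have "range z \<subseteq> cball 0 1"
    proof -
      have "norm (x (r n) - l) \<le> 2" for n
      proof -
        have "norm (x (r n)) \<le> 1" "norm l \<le> 1"
          using K(1) x(1)[of "r n"] l(1) by auto
        then show ?thesis
          using norm_triangle_ineq4[of "x (r n)" l] by linarith
      qed
      then show ?thesis
        by (auto simp: z_def)
    qed
    ultimately have beta: "limsup (\<lambda>n. ennreal (norm (blinfun_apply (g n) (z n)))) \<le> beta_seq sc g"
      unfolding beta_seq_def by (intro SUP_upper) auto
    \<comment> \<open>Here \<open>g\<close> being weak-star null enters: the contribution of
      \<open>l\<close> eventually drops below the gap \<open>c' - c\<close>.\<close>
    have "(\<lambda>n. blinfun_apply (g (p n)) l) \<longlonglongrightarrow> 0"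
      using null p LIMSEQ_subseq_LIMSEQ unfolding weak_star_null_def o_def by fastforce
    then have "eventually (\<lambda>n. norm (blinfun_apply (g (p n)) l) < c' - c) sequentially"
      using c by (auto dest: tendstoD[of _ _ _ "c' - c"])
    then have "eventually (\<lambda>n. ennreal (c/2) \<le> ennreal (norm (blinfun_apply (g (p n)) (z (p n))))) sequentially"
    proof eventually_elim
      case (elim n)
      have "c' < norm (blinfun_apply (g (p n)) (x (r n)))"
        using x(2) by (simp add: p_def)
      also have "\<dots> \<le> norm (blinfun_apply (g (p n)) l)
          + norm (blinfun_apply (g (p n)) (x (r n)) - blinfun_apply (g (p n)) l)"
        by (rule norm_triangle_sub)
      finally show ?case
        using elim by (intro ennreal_leI) (simp add: zp blinfun.scaleR_right blinfun.diff_right)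
    qed
    then have "ennreal (c/2) \<le> limsup ((\<lambda>n. ennreal (norm (blinfun_apply (g n) (z n)))) \<circ> p)"
      by (intro le_Limsup) (simp_all add: o_def)
    also have "\<dots> \<le> beta_seq sc g"
      using limsup_subseq_mono[OF p] beta by (rule order_trans)
    finally have "2 * ennreal (c/2) \<le> 2 * beta_seq sc g"
      by (rule mult_left_mono) simp
    moreover have "2 * ennreal (c/2) = a"
      using c by (simp flip: ennreal_numeral ennreal_mult)
    ultimately show "a \<le> 2 * beta_seq sc g"
      by simp
  qed
qed

section \<open>Comparison of \<open>alpha_seq\<close> with \<open>ca_rho_star\<close>\<close>

text \<open>Letting \<open>l\<close> tend to infinity in \<open>g k - g l\<close> at a fixed point
  leaves \<open>g k\<close>. With limsup written as an infimum of tail suprema, the two sides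
  compare tail by tail.\<close>

lemma alpha_seq_le_ca_rho_star:
  fixes g :: "nat \<Rightarrow> 'a::banach \<Rightarrow>\<^sub>L 'k::real_normed_field"
  assumes null: "weak_star_null g"
  shows "alpha_seq sc g \<le> ca_rho_star sc g"
  unfolding alpha_seq_def ca_rho_star_def limsup_INF_SUP
proof (rule SUP_mono', rule INF_mono', rule SUP_least, rule SUP_least)
  fix K :: "'a set" and n k :: nat and x :: 'a
  assume k: "k \<in> {n..}" and x: "x \<in> K"
  let ?R = "SUP k\<in>{n..}. SUP l\<in>{n..}. SUP x\<in>K. ennreal (norm (blinfun_apply (g k - g l) x))"
  have "(\<lambda>l. norm (blinfun_apply (g k - g l) x)) \<longlonglongrightarrow> norm (blinfun_apply (g k) x - 0)"
    using null unfolding blinfun.diff_left weak_star_null_def by (intro tendsto_intros) auto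
  then have "(\<lambda>l. ennreal (norm (blinfun_apply (g k - g l) x))) \<longlonglongrightarrow> ennreal (norm (blinfun_apply (g k) x))"
    by (intro tendsto_ennrealI) simp
  moreover have "ennreal (norm (blinfun_apply (g k - g l) x)) \<le> ?R" if "l \<ge> n" for l
    using that k x by (intro SUP_upper2[of k] SUP_upper2[of l] SUP_upper2[of x]) auto
  ultimately show "ennreal (norm (blinfun_apply (g k) x)) \<le> ?R"
    using LIMSEQ_le_const2 by blast
qed

text \<open>Division by the finite nonzero \<open>c\<close> turns the hypothesis into a lower bound
  for every \<open>f i\<close>. It moves constants across the infima over tails and over block
  subsequences.\<close>

lemma le_mult_INF_ennreal:
  fixes c :: ennreal
  assumes c: "0 < c" "c < top" and le: "\<And>i. i \<in> A \<Longrightarrow> a \<le> c * f i"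
  shows "a \<le> c * (INF i\<in>A. f i)"
proof -
  have "a / c \<le> (INF i\<in>A. f i)"
  proof (rule INF_greatest)
    fix i assume "i \<in> A"
    then show "a / c \<le> f i"
      using le[of i] c by (simp add: divide_le_posI_ennreal mult.commute)
  qed
  then have "c * (a / c) \<le> c * (INF i\<in>A. f i)"
    by (rule mult_left_mono) simp
  with c show ?thesis
    by (simp add: ennreal_times_divide ennreal_mult_divide_eq mult.commute)
qed

text \<open>The shift \<open>u\<close> cancels in differences; the scaling contributes one factor 2
  and the triangle inequality the other.\<close>

lemma ca_rho_star_affine_le_alpha_seq:
  "ca_rho_star sc (\<lambda>n. u + 2 *\<^sub>R g n) \<le> 4 * alpha_seq sc g"
  unfolding ca_rho_star_def
proof (rule SUP_least)
  fix K
  assume K: "K \<in> weakly_compact_in_ball sc"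
  let ?s = "\<lambda>n. SUP x\<in>K. ennreal (norm (blinfun_apply (g n) x))"
  let ?d = "\<lambda>k l x. ennreal (norm (blinfun_apply (u + 2 *\<^sub>R g k - (u + 2 *\<^sub>R g l)) x))"
  have "(INF n. SUP k\<in>{n..}. SUP l\<in>{n..}. SUP x\<in>K. ?d k l x) \<le> 4 * limsup ?s"
    unfolding limsup_INF_SUP
  proof (rule le_mult_INF_ennreal)
    fix n :: nat
    let ?S = "SUP m\<in>{n..}. ?s m"
    have "?d k l x \<le> 4 * ?S" if "k \<ge> n" "l \<ge> n" "x \<in> K" for k l x
    proof -
      have S: "ennreal (norm (blinfun_apply (g m) x)) \<le> ?S" if "m \<ge> n" for m
        using that \<open>x \<in> K\<close> by (intro SUP_upper2[of m] SUP_upper2[of x]) auto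
      have "norm (blinfun_apply (u + 2 *\<^sub>R g k - (u + 2 *\<^sub>R g l)) x)
          = 2 * norm (blinfun_apply (g k) x - blinfun_apply (g l) x)"
        by (simp add: blinfun.diff_left blinfun.scaleR_left flip: scaleR_diff_right)
      also have "\<dots> \<le> 2 * (norm (blinfun_apply (g k) x) + norm (blinfun_apply (g l) x))"
        using norm_triangle_ineq4 by (intro mult_left_mono) auto
      finally have "?d k l x \<le> ennreal (2 * (norm (blinfun_apply (g k) x) + norm (blinfun_apply (g l) x)))"
        by (rule ennreal_leI)
      also have "\<dots> = 2 * (ennreal (norm (blinfun_apply (g k) x)) + ennreal (norm (blinfun_apply (g l) x)))"
        by (simp add: ennreal_mult)
      also have "\<dots> \<le> 2 * (?S + ?S)"
        using S that by (intro mult_left_mono add_mono) auto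
      also have "\<dots> = 4 * ?S"
        by (simp flip: mult_2 mult.assoc)
      finally show ?thesis .
    qed
    then have "(SUP k\<in>{n..}. SUP l\<in>{n..}. SUP x\<in>K. ?d k l x) \<le> 4 * ?S"
      by (intro SUP_least) auto
    then show "(INF n. SUP k\<in>{n..}. SUP l\<in>{n..}. SUP x\<in>K. ?d k l x) \<le> 4 * ?S"
      by (rule INF_lower2[OF UNIV_I])
  qed auto
  also have "\<dots> \<le> 4 * alpha_seq sc g"
    unfolding alpha_seq_def using K by (intro mult_left_mono SUP_upper) auto
  finally show "(INF n. SUP k\<in>{n..}. SUP l\<in>{n..}. SUP x\<in>K. ?d k l x) \<le> 4 * alpha_seq sc g" .
qed

section \<open>Convex block subsequences and weak-star limits\<close>

text \<open>Since \<open>k n \<ge> n\<close>, block \<open>n\<close> uses only terms of index at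
  least \<open>n\<close>. At a given point these eventually take values in a small ball, whose
  preimage under evaluation is convex and so contains the hull of the block.\<close>

lemma weak_star_null_cbs:
  assumes null: "weak_star_null f" and g: "g \<in> cbs f"
  shows "weak_star_null g"
  unfolding weak_star_null_def
proof (intro allI LIMSEQ_I)
  fix x and e :: real
  assume "0 < e"
  then obtain N where N: "\<And>n. n \<ge> N \<Longrightarrow> norm (blinfun_apply (f n) x) < e"
    using null LIMSEQ_D[of "\<lambda>n. blinfun_apply (f n) x" 0] unfolding weak_star_null_def by fastforce
  obtain k where k: "strict_mono k" "\<And>n. g n \<in> convex hull (f ` {k n..<k (Suc n)})"
    using g by (auto simp: cbs_def)
  have "convex ((\<lambda>\<phi>. blinfun_apply \<phi> x) -` ball 0 e)"
    by (intro convex_linear_vimage bounded_linear.linear convex_ball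
        blinfun.bounded_linear_left)
  moreover have "f ` {k n..<k (Suc n)} \<subseteq> (\<lambda>\<phi>. blinfun_apply \<phi> x) -` ball 0 e" if "n \<ge> N" for n
    using that N seq_suble[OF k(1), of n] by fastforce
  ultimately have "g n \<in> (\<lambda>\<phi>. blinfun_apply \<phi> x) -` ball 0 e" if "n \<ge> N" for n
    using that k(2) hull_minimal by (metis subsetD)
  then show "\<exists>N. \<forall>n\<ge>N. norm (blinfun_apply (g n) x - 0) < e"
    by auto
qed

text \<open>Affine maps commute with convex hulls, so the same block boundaries \<open>k\<close>
  serve.\<close>

lemma cbs_affinity:
  assumes "g \<in> cbs f"
  shows "(\<lambda>n. u + c *\<^sub>R g n) \<in> cbs (\<lambda>n. u + c *\<^sub>R f n)"
proof -
  obtain k where k: "k 0 = 0" "strict_mono k" "\<And>n. g n \<in> convex hull (f ` {k n..<k (Suc n)})"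
    using assms by (auto simp: cbs_def)
  have "u + c *\<^sub>R g n \<in> convex hull ((\<lambda>n. u + c *\<^sub>R f n) ` {k n..<k (Suc n)})" for n
  proof -
    have "(\<lambda>n. u + c *\<^sub>R f n) ` {k n..<k (Suc n)} = (\<lambda>v. u + c *\<^sub>R v) ` f ` {k n..<k (Suc n)}"
      by (simp add: image_image)
    then have "convex hull ((\<lambda>n. u + c *\<^sub>R f n) ` {k n..<k (Suc n)}) =
        (\<lambda>v. u + c *\<^sub>R v) ` (convex hull (f ` {k n..<k (Suc n)}))"
      by (simp only: convex_hull_affinity)
    with k(3)[of n] show ?thesis
      by blast
  qed
  with k(1,2) show ?thesis
    unfolding cbs_def by blast
qed

text \<open>Scalar completeness gives a pointwise limit, and every condition in
  \<open>dual_ball_apply_image\<close> passes to pointwise limits.\<close>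

lemma weak_star_Cauchy_limit:
  fixes sc :: "'k::{real_normed_field, euclidean_space} \<Rightarrow> 'a::banach \<Rightarrow> 'a"
  assumes f: "range f \<subseteq> dual_space sc \<inter> cball 0 1" and Cauchy: "weak_star_Cauchy f"
  obtains u where "u \<in> dual_space sc \<inter> cball 0 1"
    "\<And>x. (\<lambda>n. blinfun_apply (f n) x) \<longlonglongrightarrow> blinfun_apply u x"
proof -
  define \<phi> where "\<phi> x = lim (\<lambda>n. blinfun_apply (f n) x)" for x
  have lim: "(\<lambda>n. blinfun_apply (f n) x) \<longlonglongrightarrow> \<phi> x" for x
    using Cauchy unfolding weak_star_Cauchy_def \<phi>_def
    by (simp add: Cauchy_convergent_iff convergent_LIMSEQ_iff)
  have fn: "blinfun_apply (f n) \<in> blinfun_apply ` (dual_space sc \<inter> cball 0 1)" for n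
    using f by blast
  have bd: "norm (blinfun_apply (f n) x) \<le> norm x" for n x
    using fn[of n] unfolding dual_ball_apply_image by blast
  have sc: "blinfun_apply (f n) (sc c x) = c * blinfun_apply (f n) x" for n c x
    using fn[of n] unfolding dual_ball_apply_image by blast
  have "norm (\<phi> x) \<le> norm x" for x
    using bd by (intro LIMSEQ_le_const2[OF tendsto_norm[OF lim]]) auto
  moreover have "\<phi> (x + y) = \<phi> x + \<phi> y" for x y
    using tendsto_add[OF lim[of x] lim[of y]] lim[of "x + y"]
    by (simp add: blinfun.add_right LIMSEQ_unique)
  moreover have "\<phi> (r *\<^sub>R x) = r *\<^sub>R \<phi> x" for r x
    using tendsto_scaleR[OF tendsto_const[of r] lim[of x]] lim[of "r *\<^sub>R x"]
    by (simp add: blinfun.scaleR_right LIMSEQ_unique)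
  moreover have "\<phi> (sc c x) = c * \<phi> x" for c x
    using tendsto_mult[OF tendsto_const[of c] lim[of x]] lim[of "sc c x"]
    by (simp add: sc LIMSEQ_unique)
  ultimately have "\<phi> \<in> blinfun_apply ` (dual_space sc \<inter> cball 0 1)"
    unfolding dual_ball_apply_image by blast
  then obtain u where "u \<in> dual_space sc \<inter> cball 0 1" "\<phi> = blinfun_apply u"
    by blast
  with lim that show ?thesis by metis
qed

section \<open>The four inequalities\<close>

lemma K2_le_K1: "K2 sc \<le> K1 sc"
  unfolding K1_def K2_def by (intro SUP_mono' INF_mono' beta_seq_le_alpha_seq)

lemma K1_le_2_K2:
  fixes sc :: "'k::{real_normed_field, euclidean_space} \<Rightarrow> 'a::banach \<Rightarrow> 'a"
  shows "K1 sc \<le> 2 * K2 sc"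
  unfolding K1_def
proof (rule SUP_least, safe)
  fix f :: "nat \<Rightarrow> 'a \<Rightarrow>\<^sub>L 'k"
  assume f: "range f \<subseteq> dual_space sc \<inter> cball 0 1" "weak_star_null f"
  have "(INF g\<in>cbs f. alpha_seq sc g) \<le> 2 * (INF g\<in>cbs f. beta_seq sc g)"
    using f(2) by (intro le_mult_INF_ennreal)
      (auto intro!: INF_lower2 alpha_seq_le_beta_seq weak_star_null_cbs)
  also have "\<dots> \<le> 2 * K2 sc"
    unfolding K2_def using f by (intro mult_left_mono SUP_upper) auto
  finally show "(INF g\<in>cbs f. alpha_seq sc g) \<le> 2 * K2 sc" .
qed

text \<open>Weak-star null sequences are weak-star Cauchy, so \<open>K3\<close> takes its supremum
  over a larger family.\<close>

lemma K1_le_K3: "K1 sc \<le> K3 sc"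
  unfolding K1_def
proof (rule SUP_least, safe)
  fix f
  assume f: "range f \<subseteq> dual_space sc \<inter> cball 0 1" "weak_star_null f"
  have "weak_star_Cauchy f"
    using f(2) unfolding weak_star_Cauchy_def weak_star_null_def by (blast intro: LIMSEQ_imp_Cauchy)
  have "(INF g\<in>cbs f. alpha_seq sc g) \<le> (INF g\<in>cbs f. ca_rho_star sc g)"
    using f(2) by (intro INF_mono) (blast intro: alpha_seq_le_ca_rho_star weak_star_null_cbs)
  also have "\<dots> \<le> K3 sc"
    unfolding K3_def using f \<open>weak_star_Cauchy f\<close> by (intro SUP_upper) auto
  finally show "(INF g\<in>cbs f. alpha_seq sc g) \<le> K3 sc" .
qed

lemma K3_le_4_K1:
  fixes sc :: "'k::{real_normed_field, euclidean_space} \<Rightarrow> 'a::banach \<Rightarrow> 'a"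
  shows "K3 sc \<le> 4 * K1 sc"
  unfolding K3_def
proof (rule SUP_least, safe)
  fix f :: "nat \<Rightarrow> 'a \<Rightarrow>\<^sub>L 'k"
  assume f: "range f \<subseteq> dual_space sc \<inter> cball 0 1" "weak_star_Cauchy f"
  then obtain u where u: "u \<in> dual_space sc \<inter> cball 0 1"
    "\<And>x. (\<lambda>n. blinfun_apply (f n) x) \<longlonglongrightarrow> blinfun_apply u x"
    using weak_star_Cauchy_limit by blast
  \<comment> \<open>Both \<open>f n\<close> and \<open>u\<close> have norm at most 1, so halving
    their difference keeps \<open>h\<close> in the dual ball.\<close>
  define h where "h n = (1/2) *\<^sub>R (f n - u)" for n
  have f_eq: "f = (\<lambda>n. u + 2 *\<^sub>R h n)"
    by (simp add: h_def)
  have "h n \<in> dual_space sc \<inter> cball 0 1" for n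
  proof -
    have fn: "f n \<in> dual_space sc \<inter> cball 0 1"
      using f(1) by blast
    then have "norm (f n - u) \<le> 2"
      using u(1) norm_triangle_ineq4[of "f n" u] by simp
    then have "norm (h n) \<le> 1"
      by (simp add: h_def)
    moreover have "h n \<in> dual_space sc"
      using fn u(1) by (simp add: h_def dual_space_def blinfun.scaleR_left blinfun.diff_left algebra_simps)
    ultimately show ?thesis
      by simp
  qed
  moreover have "weak_star_null h"
    unfolding weak_star_null_def
  proof
    fix x
    have "(\<lambda>n. (1/2) *\<^sub>R (blinfun_apply (f n) x - blinfun_apply u x)) \<longlonglongrightarrow> (1/2) *\<^sub>R 0"
      by (intro tendsto_scaleR tendsto_const LIM_zero u(2))
    then show "(\<lambda>n. blinfun_apply (h n) x) \<longlonglongrightarrow> 0"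
      by (simp add: h_def blinfun.scaleR_left blinfun.diff_left)
  qed
  ultimately have h: "h \<in> {f. range f \<subseteq> dual_space sc \<inter> cball 0 1 \<and> weak_star_null f}"
    by auto
  \<comment> \<open>An upper bound for the left infimum needs only the members of
    \<open>cbs f\<close> of the form \<open>u + 2 g\<close> with \<open>g\<close> in
    \<open>cbs h\<close>.\<close>
  have "(INF g\<in>cbs f. ca_rho_star sc g) \<le> 4 * (INF g\<in>cbs h. alpha_seq sc g)"
  proof (rule le_mult_INF_ennreal)
    fix g
    assume "g \<in> cbs h"
    then have "(\<lambda>n. u + 2 *\<^sub>R g n) \<in> cbs f"
      unfolding f_eq by (rule cbs_affinity)
    then show "(INF g\<in>cbs f. ca_rho_star sc g) \<le> 4 * alpha_seq sc g"
      by (rule INF_lower2) (rule ca_rho_star_affine_le_alpha_seq)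
  qed auto
  also have "\<dots> \<le> 4 * K1 sc"
    unfolding K1_def using h by (intro mult_left_mono SUP_upper) auto
  finally show "(INF g\<in>cbs f. ca_rho_star sc g) \<le> 4 * K1 sc" .
qed

theorem proposition3p5:
  fixes cscale :: "complex \<Rightarrow> 'b::banach \<Rightarrow> 'b"
  shows "(infdim_banach_space (scaleR :: real \<Rightarrow> 'a::banach \<Rightarrow> 'a) \<longrightarrow>
      (K2 (scaleR :: real \<Rightarrow> 'a \<Rightarrow> 'a) \<le> K1 (scaleR :: real \<Rightarrow> 'a \<Rightarrow> 'a) \<and>
       K1 (scaleR :: real \<Rightarrow> 'a \<Rightarrow> 'a) \<le> 2 * K2 (scaleR :: real \<Rightarrow> 'a \<Rightarrow> 'a)) \<and>
      (K1 (scaleR :: real \<Rightarrow> 'a \<Rightarrow> 'a) \<le> K3 (scaleR :: real \<Rightarrow> 'a \<Rightarrow> 'a) \<and>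
       K3 (scaleR :: real \<Rightarrow> 'a \<Rightarrow> 'a) \<le> 4 * K1 (scaleR :: real \<Rightarrow> 'a \<Rightarrow> 'a))) \<and>
    (infdim_banach_space cscale \<longrightarrow>
      (K2 cscale \<le> K1 cscale \<and> K1 cscale \<le> 2 * K2 cscale) \<and>
      (K1 cscale \<le> K3 cscale \<and> K3 cscale \<le> 4 * K1 cscale))"
  by (intro conjI impI K2_le_K1 K1_le_2_K2 K1_le_K3 K3_le_4_K1)

end
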